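(* Let $A\in\mathbb{R}^{n\times n}$ be invertible and symmetric, $M=I-A$, with distinct eigenvalues $a_1,\dots,a_p$ of $A$ and, for each $i$, an orthonormal basis $u_{i,1},\dots,u_{i,n_i}$ of the eigenspace of $a_i$. Let $i_1\neq i_2$ in $\{1,\dots,p\}$ and consider $$u^*=\sum_{s=1}^{n_{i_1}}c_{i_1,s}u_{i_1,s}+\sum_{r=1}^{n_{i_2}}c_{i_2,r}u_{i_2,r},\qquad c_{i_1,1}c_{i_2,1}\neq0,$$ and $u_{i_1i_2}=c_{i_1}u_{i_1,s_1}+c_{i_2}u_{i_2,r_1}$ with $s_1\in\{1,\dots,n_{i_1}\}$, $r_1\in\{1,\dots,n_{i_2}\}$, where $$c_{i_1}^2=\sum_{s=1}^{n_{i_1}}c_{i_1,s}^2,\qquad c_{i_2}^2=\sum_{r=1}^{n_{i_2}}c_{i_2,r}^2 .$$ Then $\Upsilon(u_{i_1i_2})u_{i_1i_2}=\mu_{i_1i_2}u_{i_1i_2}$ and $\Upsilon(u^* )u^*=\mu_{i_1i_2}u^*$, where $\mu_{i_1i_2}=\mu_{i_1i_2}(\epsilon_{i_1i_2})$ with $\epsilon_{i_1i_2}=\frac{c_{i_2}}{c_{i_1}}$ and $$\mu_{i_1i_2}(\epsilon)=\frac{(a_{i_2}-a_{i_1})^2}{a_{i_1}^2+\epsilon^2a_{i_2}^2}\cdot\frac{\big((1-a_{i_1})(1-a_{i_2})\big)^2}{(1-a_{i_1})^2+\frac{(1-a_{i_2})^2}{\epsilon^2}}\qquad(\epsilon\in\mathbb{R}\setminus\{0\}).$$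 Moreover, $$\max_{\epsilon\in\mathbb{R}\setminus\{0\}}\mu_{i_1i_2}(\epsilon)=\left(\frac{(1-a_{i_1})(1-a_{i_2})(a_{i_1}-a_{i_2})}{|(1-a_{i_1})a_{i_1}|+|(1-a_{i_2})a_{i_2}|}\right)^2,$$ and, when $a_{i_1}\neq1$ and $a_{i_2}\neq1$, this maximum is attained at $\epsilon=\pm\sqrt{\left|\frac{(1-a_{i_2})a_{i_1}}{(1-a_{i_1})a_{i_2}}\right|}$.
   Context: $\langle\cdot,\cdot\rangle$ is the Euclidean inner product. For $0\neq v\in\mathbb{R}^n$, $\alpha(v)=\frac{\langle v,Av\rangle}{\langle Av,Av\rangle}$ and $\Psi(v)=M(I-\alpha(v)A)v$. For $v\neq0$ with $\Psi(v)\neq0$, $\Upsilon(v)=M(I-\alpha(\Psi(v))A)M(I-\alpha(v)A)$. *)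

theory Defs
  imports "HOL-Analysis.Analysis"
begin

definition eigenspace :: "real^'n^'n \<Rightarrow> real \<Rightarrow> (real^'n) set" where
  "eigenspace A a = {v. A *v v = a *\<^sub>R v}"

definition is_eigenvalue :: "real^'n^'n \<Rightarrow> real \<Rightarrow> bool" where
  "is_eigenvalue A a \<longleftrightarrow> (\<exists>v. v \<noteq> 0 \<and> A *v v = a *\<^sub>R v)"

text \<open>Orthonormality is a condition on the indexed family \<open>u 1, \<dots>, u m\<close>, so it also rules out
  repetitions; together with the span condition the family is a basis.\<close>

definition orthonormal_basis_of :: "(real^'n) set \<Rightarrow> nat \<Rightarrow> (nat \<Rightarrow> real^'n) \<Rightarrow> bool" where
  "orthonormal_basis_of S m u \<longleftrightarrow>
     (\<forall>s\<in>{1..m}. \<forall>t\<in>{1..m}. u s \<bullet> u t = (if s = t then 1 else 0)) \<and>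
     span (u ` {1..m}) = S"

definition Mmat :: "real^'n^'n \<Rightarrow> real^'n^'n" where
  "Mmat A = mat 1 - A"

definition alpha :: "real^'n^'n \<Rightarrow> real^'n \<Rightarrow> real" where
  "alpha A v = (v \<bullet> (A *v v)) / ((A *v v) \<bullet> (A *v v))"

text \<open>\<open>alpha\<close> and \<open>Psi\<close> are meant for \<open>v \<noteq> 0\<close>, and \<open>Upsilon\<close> for \<open>v \<noteq> 0\<close> with \<open>Psi A v \<noteq> 0\<close>;
  elsewhere their values are artefacts of division by zero. \<open>Upsilon_defined\<close> is the domain
  of \<open>Upsilon\<close>.\<close>

definition Psi :: "real^'n^'n \<Rightarrow> real^'n \<Rightarrow> real^'n" where
  "Psi A v = (Mmat A ** (mat 1 - alpha A v *\<^sub>R A)) *v v"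

definition Upsilon_defined :: "real^'n^'n \<Rightarrow> real^'n \<Rightarrow> bool" where
  "Upsilon_defined A v \<longleftrightarrow> v \<noteq> 0 \<and> Psi A v \<noteq> 0"

definition Upsilon :: "real^'n^'n \<Rightarrow> real^'n \<Rightarrow> real^'n^'n" where
  "Upsilon A v =
     Mmat A ** (mat 1 - alpha A (Psi A v) *\<^sub>R A) ** Mmat A ** (mat 1 - alpha A v *\<^sub>R A)"

text \<open>\<open>mu a b\<close> is the function \<open>\<mu>\<^sub>i\<^sub>j\<close> for the eigenvalues \<open>a = a\<^sub>i\<close>, \<open>b = a\<^sub>j\<close>,
  intended for \<open>\<epsilon> \<noteq> 0\<close>.\<close>

definition mu :: "real \<Rightarrow> real \<Rightarrow> real \<Rightarrow> real" where
  "mu a b \<epsilon> = (b - a)\<^sup>2 / (a\<^sup>2 + \<epsilon>\<^sup>2 * b\<^sup>2) *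
     (((1 - a) * (1 - b))\<^sup>2 / ((1 - a)\<^sup>2 + (1 - b)\<^sup>2 / \<epsilon>\<^sup>2))"

definition is_max_value :: "('a \<Rightarrow> real) \<Rightarrow> 'a set \<Rightarrow> real \<Rightarrow> bool" where
  "is_max_value f S m \<longleftrightarrow> (\<exists>x\<in>S. f x = m) \<and> (\<forall>x\<in>S. f x \<le> m)"

end

theory Submission
  imports Defs
begin

text \<open>
  Since \<open>Upsilon A v *v v = Psi A (Psi A v)\<close>, everything reduces to one step \<open>Psi\<close> on a sum
  \<open>x + y\<close> of orthogonal eigenvectors for distinct nonzero eigenvalues \<open>a\<close>, \<open>b\<close>.
  With \<open>X = x \<bullet> x\<close>, \<open>Y = y \<bullet> y\<close> and
  \<open>D = a\<^sup>2 X + b\<^sup>2 Y\<close>, the choice of \<open>alpha\<close> makes the two factors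
  \<open>1 - alpha a = b Y (b - a) / D\<close> and \<open>1 - alpha b = - a X (b - a) / D\<close>: each component
  is rescaled by the squared norm of the other one. The ratio of the norms of the two components
  is therefore inverted up to a constant, so a second step restores it, and \<open>x + y\<close> is
  reproduced up to a factor (\<open>Psi_eigenvector_sum\<close>, \<open>Upsilon_eigenvector_sum\<close>); the factor is
  \<open>0\<close> if one of the eigenvalues is \<open>1\<close>, since \<open>M\<close> then kills one component at the first step
  and the second step annihilates the single eigenvector that is left. The factor
  depends on \<open>x\<close>, \<open>y\<close> through \<open>Y / X\<close> only, which is why the vectors \<open>u12\<close> and \<open>ustar\<close>, whose
  components have the same norms, share it.

  For the maximum, multiply out the two denominators of \<open>mu\<close>: the only terms depending on
  \<open>\<epsilon>\<close> are \<open>((1 - a) b \<epsilon>)\<^sup>2 + ((1 - b) a / \<epsilon>)\<^sup>2\<close>, and the product of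
  these two squares is constant. Completing the square (\<open>mu_denominator_expand\<close>), as in the
  inequality between arithmetic and geometric means, writes the product of the denominators as
  a constant square plus a square that vanishes exactly when the two terms agree; this yields
  both the bound (\<open>mu_le_max\<close>) and the points where it is attained (\<open>mu_eq_max\<close>).
\<close>

section \<open>Orthogonal eigenvectors\<close>

lemma symmetric_eigenvectors_orthogonal:
  fixes A :: "real^'n^'n"
  assumes "transpose A = A" "A *v x = a *\<^sub>R x" "A *v y = b *\<^sub>R y" "a \<noteq> b"
  shows "x \<bullet> y = 0"
proof -
  have "(A *v x) \<bullet> y = x \<bullet> (A *v y)"
    using assms(1) by (metis dot_lmul_matrix vector_transpose_matrix)
  then show ?thesis
    using assms by simp
qed

lemma invertible_eigenvalue_nonzero:
  fixes A :: "real^'n^'n"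
  assumes "invertible A" "A *v x = a *\<^sub>R x" "x \<noteq> 0"
  shows "a \<noteq> 0"
proof
  assume "a = 0"
  then have "A *v x = A *v 0"
    using assms(2) by simp
  then show False
    using assms(1,3) by (metis injD inj_matrix_vector_mult)
qed

lemma orthonormal_basis_of_combination:
  assumes "orthonormal_basis_of (eigenspace A a) m u"
  shows "A *v (\<Sum>s = 1..m. c s *\<^sub>R u s) = a *\<^sub>R (\<Sum>s = 1..m. c s *\<^sub>R u s)"
    and "(\<Sum>s = 1..m. c s *\<^sub>R u s) \<bullet> (\<Sum>s = 1..m. c s *\<^sub>R u s) = (\<Sum>s = 1..m. (c s)\<^sup>2)"
proof -
  have "(\<Sum>s = 1..m. c s *\<^sub>R u s) \<in> span (u ` {1..m})"
    by (intro span_sum span_scale span_base) auto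
  then show "A *v (\<Sum>s = 1..m. c s *\<^sub>R u s) = a *\<^sub>R (\<Sum>s = 1..m. c s *\<^sub>R u s)"
    using assms by (auto simp: orthonormal_basis_of_def eigenspace_def)
  have "(\<Sum>s = 1..m. c s *\<^sub>R u s) \<bullet> (\<Sum>t = 1..m. c t *\<^sub>R u t)
      = (\<Sum>s = 1..m. \<Sum>t = 1..m. c s * (c t * (u s \<bullet> u t)))"
    by (simp only: inner_sum_left) (simp add: inner_sum_right mult.left_commute)
  also have "\<dots> = (\<Sum>s = 1..m. \<Sum>t = 1..m. if s = t then (c s)\<^sup>2 else 0)"
    using assms
    by (intro sum.cong refl) (auto simp: orthonormal_basis_of_def power2_eq_square)
  finally show "(\<Sum>s = 1..m. c s *\<^sub>R u s) \<bullet> (\<Sum>s = 1..m. c s *\<^sub>R u s) = (\<Sum>s = 1..m. (c s)\<^sup>2)"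
    by simp
qed

section \<open>Two steps on a sum of two eigenvectors\<close>

lemma Psi_expand:
  "Psi A v = (v - alpha A v *\<^sub>R (A *v v)) - A *v (v - alpha A v *\<^sub>R (A *v v))"
  by (simp add: Psi_def Mmat_def matrix_vector_mul_assoc[symmetric]
      matrix_vector_mult_diff_rdistrib scaleR_matrix_vector_assoc[symmetric])

lemma Upsilon_eq_Psi_Psi: "Upsilon A v *v v = Psi A (Psi A v)"
  by (simp add: Upsilon_def Psi_def matrix_vector_mul_assoc matrix_mul_assoc)

text \<open>In \<open>1 - alpha a\<close>, over the common denominator \<open>D = a\<^sup>2 (x \<bullet> x) + b\<^sup>2 (y \<bullet> y)\<close>, the terms in
  \<open>x \<bullet> x\<close> cancel and only a multiple of \<open>y \<bullet> y\<close> remains; symmetrically for \<open>1 - alpha b\<close>. Vanishing components are allowed, because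
  the first step annihilates a component whose eigenvalue is \<open>1\<close>.\<close>

lemma Psi_eigenvector_sum:
  fixes A :: "real^'n^'n"
  assumes Ax: "A *v x = a *\<^sub>R x" and Ay: "A *v y = b *\<^sub>R y" and "x \<bullet> y = 0"
    and D: "a\<^sup>2 * (x \<bullet> x) + b\<^sup>2 * (y \<bullet> y) \<noteq> 0"
  defines "k \<equiv> (b - a) / (a\<^sup>2 * (x \<bullet> x) + b\<^sup>2 * (y \<bullet> y))"
  shows "Psi A (x + y) =
    (k * (1 - a) * b * (y \<bullet> y)) *\<^sub>R x + (- k * (1 - b) * a * (x \<bullet> x)) *\<^sub>R y"
proof -
  define X Y d where defs: "X = x \<bullet> x" "Y = y \<bullet> y" "d = a\<^sup>2 * X + b\<^sup>2 * Y"
  define \<alpha> where "\<alpha> = (a * X + b * Y) / d"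
  have Axy: "A *v (x + y) = a *\<^sub>R x + b *\<^sub>R y"
    by (simp add: matrix_vector_right_distrib Ax Ay)
  have "alpha A (x + y) = \<alpha>"
    unfolding alpha_def Axy \<alpha>_def defs using \<open>x \<bullet> y = 0\<close>
    by (simp add: inner_add_left inner_add_right inner_commute[of y x] power2_eq_square)
  moreover have "(x + y) - \<alpha> *\<^sub>R (a *\<^sub>R x + b *\<^sub>R y)
      = (1 - \<alpha> * a) *\<^sub>R x + (1 - \<alpha> * b) *\<^sub>R y"
    by (simp add: algebra_simps)
  ultimately have Psi: "Psi A (x + y) = ((1 - \<alpha> * a) * (1 - a)) *\<^sub>R x + ((1 - \<alpha> * b) * (1 - b)) *\<^sub>R y"
    unfolding Psi_expand Axy
    by (simp add: matrix_vector_right_distrib matrix_vector_mult_scaleR Ax Ay) (simp add: algebra_simps)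
  have "d \<noteq> 0" "k = (b - a) / d"
    using D by (simp_all add: k_def defs)
  then have "1 - \<alpha> * a = (d - (a * X + b * Y) * a) / d"
    "1 - \<alpha> * b = (d - (a * X + b * Y) * b) / d"
    by (simp_all add: \<alpha>_def diff_divide_distrib)
  moreover have "d - (a * X + b * Y) * a = (b - a) * b * Y"
    "d - (a * X + b * Y) * b = (a - b) * a * X"
    by (simp_all add: defs(3) algebra_simps power2_eq_square)
  ultimately have "1 - \<alpha> * a = k * b * Y" "1 - \<alpha> * b = - k * a * X"
    by (simp_all add: \<open>k = (b - a) / d\<close>) (simp add: algebra_simps diff_divide_distrib)
  then show ?thesis
    by (simp add: Psi defs(1,2) mult_ac)
qed

text \<open>Write \<open>Psi A (x + y) = f x + g y\<close>. The second step multiplies \<open>x\<close> by a multiple of \<open>f g\<^sup>2 Y\<close>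
  and \<open>y\<close> by a multiple of \<open>f\<^sup>2 g X\<close>; inserting \<open>f\<close> and \<open>g\<close> makes the two factors equal.\<close>

lemma Upsilon_eigenvector_sum:
  fixes A :: "real^'n^'n"
  assumes Ax: "A *v x = a *\<^sub>R x" and Ay: "A *v y = b *\<^sub>R y" and xy: "x \<bullet> y = 0"
    and ab: "a \<noteq> 0" "b \<noteq> 0" "a \<noteq> b"
    and nonzero: "x \<noteq> 0" "y \<noteq> 0"
    and ratio: "\<epsilon>\<^sup>2 = (y \<bullet> y) / (x \<bullet> x)"
  shows "Upsilon_defined A (x + y)"
    and "Upsilon A (x + y) *v (x + y) = mu a b \<epsilon> *\<^sub>R (x + y)"
proof -
  define X Y where "X = x \<bullet> x" and "Y = y \<bullet> y"
  define d e where "d = a\<^sup>2 * X + b\<^sup>2 * Y" and "e = (1 - a)\<^sup>2 * Y + (1 - b)\<^sup>2 * X"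
  define k where "k = (b - a) / d"
  define f g where "f = k * (1 - a) * b * Y" and "g = - k * (1 - b) * a * X"
  have X: "X > 0" and Y: "Y > 0"
    using nonzero by (simp_all add: X_def Y_def)
  have d: "d > 0"
    unfolding d_def using ab X Y by (intro add_pos_pos mult_pos_pos) auto
  have k: "k \<noteq> 0"
    using d ab by (simp add: k_def)
  \<comment> \<open>At most one of the eigenvalues is \<open>1\<close>, so at least one component survives the first step
    and the denominator of the second one, a positive multiple of \<open>e\<close>, is positive.\<close>
  have e: "e > 0"
  proof (cases "a = 1")
    case True
    then show ?thesis using ab X by (simp add: e_def)
  next
    case False
    then have "(1 - a)\<^sup>2 * Y > 0" using Y by simp
    then show ?thesis using X by (simp add: e_def add_pos_nonneg)
  qed
  have Psi: "Psi A (x + y) = f *\<^sub>R x + g *\<^sub>R y"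
    using Psi_eigenvector_sum[OF Ax Ay xy] d
    by (simp add: f_def g_def k_def d_def X_def Y_def)
  have "(f *\<^sub>R x + g *\<^sub>R y) \<bullet> (f *\<^sub>R x + g *\<^sub>R y) = f\<^sup>2 * X + g\<^sup>2 * Y"
    using xy by (simp add: inner_add_left inner_add_right inner_commute[of y x] X_def Y_def
        power2_eq_square)
  have d': "a\<^sup>2 * (f\<^sup>2 * X) + b\<^sup>2 * (g\<^sup>2 * Y) = k\<^sup>2 * a\<^sup>2 * b\<^sup>2 * X * Y * e"
    by (simp add: f_def g_def e_def power2_eq_square algebra_simps)
  have d'0: "a\<^sup>2 * (f\<^sup>2 * X) + b\<^sup>2 * (g\<^sup>2 * Y) \<noteq> 0"
    unfolding d' using k ab X Y e by simp
  have "Psi A (x + y) \<noteq> 0"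
  proof
    assume "Psi A (x + y) = 0"
    then have "f\<^sup>2 * X + g\<^sup>2 * Y = 0"
      using \<open>_ = f\<^sup>2 * X + g\<^sup>2 * Y\<close> by (simp add: Psi)
    then have "f\<^sup>2 * X = 0" "g\<^sup>2 * Y = 0"
      using X Y by (simp_all add: add_nonneg_eq_0_iff)
    then show False
      using d'0 by (metis add_0 mult_zero_right)
  qed
  moreover have "x + y \<noteq> 0"
  proof
    assume "x + y = 0"
    then have "x \<bullet> (x + y) = 0" by simp
    then show False using xy X by (simp add: inner_add_right X_def)
  qed
  ultimately show "Upsilon_defined A (x + y)"
    by (simp add: Upsilon_defined_def)
  define k' where "k' = (b - a) / (k\<^sup>2 * a\<^sup>2 * b\<^sup>2 * X * Y * e)"
  have "Psi A (f *\<^sub>R x + g *\<^sub>R y) =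
      (k' * (1 - a) * b * (g\<^sup>2 * Y)) *\<^sub>R (f *\<^sub>R x) + (- k' * (1 - b) * a * (f\<^sup>2 * X)) *\<^sub>R (g *\<^sub>R y)"
  proof -
    have fx: "(f *\<^sub>R x) \<bullet> (f *\<^sub>R x) = f\<^sup>2 * X" and gy: "(g *\<^sub>R y) \<bullet> (g *\<^sub>R y) = g\<^sup>2 * Y"
      by (simp_all add: X_def Y_def power2_eq_square)
    have "A *v (f *\<^sub>R x) = a *\<^sub>R (f *\<^sub>R x)" "A *v (g *\<^sub>R y) = b *\<^sub>R (g *\<^sub>R y)"
      "(f *\<^sub>R x) \<bullet> (g *\<^sub>R y) = 0"
      by (simp_all add: matrix_vector_mult_scaleR Ax Ay xy mult.commute)
    from Psi_eigenvector_sum[OF this] show ?thesis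
      using d'0 unfolding fx gy d' k'_def by blast
  qed
  moreover have "mu a b \<epsilon> = k * (b - a) * ((1 - a) * (1 - b))\<^sup>2 * X * Y / e"
  proof -
    have "(1 - a)\<^sup>2 + (1 - b)\<^sup>2 / (Y / X) = e / Y" "a\<^sup>2 + Y / X * b\<^sup>2 = d / X"
      using X Y by (simp_all add: e_def d_def field_simps)
    then show ?thesis
      using X Y d e ratio by (simp add: mu_def X_def[symmetric] Y_def[symmetric] k_def power2_eq_square)
  qed
  moreover have "k' * (1 - a) * b * (g\<^sup>2 * Y) * f = k * (b - a) * ((1 - a) * (1 - b))\<^sup>2 * X * Y / e"
    using k ab X Y e by (simp add: k'_def f_def g_def divide_simps) (simp add: power2_eq_square)
  moreover have "- k' * (1 - b) * a * (f\<^sup>2 * X) * g = k * (b - a) * ((1 - a) * (1 - b))\<^sup>2 * X * Y / e"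
    using k ab X Y e by (simp add: k'_def f_def g_def divide_simps) (simp add: power2_eq_square)
  ultimately show "Upsilon A (x + y) *v (x + y) = mu a b \<epsilon> *\<^sub>R (x + y)"
    unfolding Upsilon_eq_Psi_Psi Psi by (simp only: scaleR_scaleR scaleR_add_right)
qed

section \<open>Maximising the factor\<close>

lemma mu_eq_quotient:
  "mu a b \<epsilon> = ((1 - a) * (1 - b) * (a - b))\<^sup>2 /
     ((a\<^sup>2 + \<epsilon>\<^sup>2 * b\<^sup>2) * ((1 - a)\<^sup>2 + (1 - b)\<^sup>2 / \<epsilon>\<^sup>2))"
  by (simp add: mu_def power_mult_distrib power2_commute[of b a] mult_ac)

lemma mu_denominator_expand:
  fixes a b \<epsilon> :: real
  assumes "\<epsilon> \<noteq> 0"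
  shows "(a\<^sup>2 + \<epsilon>\<^sup>2 * b\<^sup>2) * ((1 - a)\<^sup>2 + (1 - b)\<^sup>2 / \<epsilon>\<^sup>2) =
    (\<bar>(1 - a) * a\<bar> + \<bar>(1 - b) * b\<bar>)\<^sup>2 + (\<bar>(1 - a) * b * \<epsilon>\<bar> - \<bar>(1 - b) * a / \<epsilon>\<bar>)\<^sup>2"
proof -
  have squares: "(p + q)\<^sup>2 + (r - s)\<^sup>2 = p\<^sup>2 + q\<^sup>2 + r\<^sup>2 + s\<^sup>2" if "p * q = r * s" for p q r s :: real
    using that by (simp add: power2_sum power2_diff)
  have "\<bar>(1 - a) * a\<bar> * \<bar>(1 - b) * b\<bar> = \<bar>(1 - a) * b * \<epsilon>\<bar> * \<bar>(1 - b) * a / \<epsilon>\<bar>"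
    using assms by (simp add: abs_mult)
  from squares[OF this]
  have "(\<bar>(1 - a) * a\<bar> + \<bar>(1 - b) * b\<bar>)\<^sup>2 + (\<bar>(1 - a) * b * \<epsilon>\<bar> - \<bar>(1 - b) * a / \<epsilon>\<bar>)\<^sup>2
     = ((1 - a) * a)\<^sup>2 + ((1 - b) * b)\<^sup>2 + ((1 - a) * b * \<epsilon>)\<^sup>2 + ((1 - b) * a / \<epsilon>)\<^sup>2"
    by (simp only: power2_abs)
  also have "\<dots> = (a\<^sup>2 + \<epsilon>\<^sup>2 * b\<^sup>2) * ((1 - a)\<^sup>2 + (1 - b)\<^sup>2 / \<epsilon>\<^sup>2)"
    using assms by (simp add: power_mult_distrib power_divide distrib_left distrib_right mult_ac)
  finally show ?thesis by simp
qed

text \<open>The degenerate case of an eigenvalue \<open>1\<close> is covered: there both sides vanish.\<close>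

lemma mu_le_max:
  assumes "\<epsilon> \<noteq> 0" "a \<noteq> 0" "b \<noteq> 0"
  shows "mu a b \<epsilon> \<le> ((1 - a) * (1 - b) * (a - b) / (\<bar>(1 - a) * a\<bar> + \<bar>(1 - b) * b\<bar>))\<^sup>2"
proof (cases "a = 1 \<or> b = 1")
  case True
  then show ?thesis by (auto simp: mu_def)
next
  case False
  then have "\<bar>(1 - a) * a\<bar> + \<bar>(1 - b) * b\<bar> > 0"
    using assms by (intro add_pos_pos) auto
  then show ?thesis
    unfolding mu_eq_quotient power_divide mu_denominator_expand[OF \<open>\<epsilon> \<noteq> 0\<close>]
    by (intro divide_left_mono mult_pos_pos add_pos_nonneg) auto
qed

lemma mu_eq_max:
  assumes "a \<noteq> 0" "b \<noteq> 0" "a \<noteq> 1" "b \<noteq> 1"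
    and \<epsilon>: "\<epsilon>\<^sup>2 = \<bar>(1 - b) * a / ((1 - a) * b)\<bar>"
  shows "mu a b \<epsilon> = ((1 - a) * (1 - b) * (a - b) / (\<bar>(1 - a) * a\<bar> + \<bar>(1 - b) * b\<bar>))\<^sup>2"
proof -
  have "\<epsilon> \<noteq> 0"
    using assms by auto
  have "\<bar>(1 - a) * b * \<epsilon>\<bar> * \<bar>\<epsilon>\<bar> = \<bar>(1 - a) * b\<bar> * \<epsilon>\<^sup>2"
    by (simp add: abs_mult power2_eq_square mult.assoc)
  also have "\<dots> = \<bar>(1 - b) * a\<bar>"
    using assms by (simp add: abs_mult)
  also have "\<dots> = \<bar>(1 - b) * a / \<epsilon>\<bar> * \<bar>\<epsilon>\<bar>"
    using \<open>\<epsilon> \<noteq> 0\<close> by simp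
  finally have "\<bar>(1 - a) * b * \<epsilon>\<bar> = \<bar>(1 - b) * a / \<epsilon>\<bar>"
    using \<open>\<epsilon> \<noteq> 0\<close> by (simp only: mult_cancel_right abs_eq_0 simp_thms)
  then show ?thesis
    unfolding mu_eq_quotient mu_denominator_expand[OF \<open>\<epsilon> \<noteq> 0\<close>] by (simp add: power_divide)
qed

theorem theorem2p17:
  fixes A :: "real^'n^'n"
    and p :: nat
    and a :: "nat \<Rightarrow> real"
    and N :: "nat \<Rightarrow> nat"
    and u :: "nat \<Rightarrow> nat \<Rightarrow> real^'n"
    and c :: "nat \<Rightarrow> nat \<Rightarrow> real"
    and i1 i2 s1 r1 :: nat
    and c1 c2 :: real
    and ustar u12 :: "real^'n"
  assumes "invertible A"
    and "transpose A = A"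
    and "inj_on a {1..p}"
    and "a ` {1..p} = {l. is_eigenvalue A l}"
    and "\<And>i. i \<in> {1..p} \<Longrightarrow> orthonormal_basis_of (eigenspace A (a i)) (N i) (u i)"
    and "i1 \<in> {1..p}" and "i2 \<in> {1..p}" and "i1 \<noteq> i2"
    and "c i1 1 * c i2 1 \<noteq> 0"
    and "ustar = (\<Sum>s = 1..N i1. c i1 s *\<^sub>R u i1 s) + (\<Sum>r = 1..N i2. c i2 r *\<^sub>R u i2 r)"
    and "s1 \<in> {1..N i1}" and "r1 \<in> {1..N i2}"
    and "c1\<^sup>2 = (\<Sum>s = 1..N i1. (c i1 s)\<^sup>2)"
    and "c2\<^sup>2 = (\<Sum>r = 1..N i2. (c i2 r)\<^sup>2)"
    and "u12 = c1 *\<^sub>R u i1 s1 + c2 *\<^sub>R u i2 r1"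
  shows "Upsilon_defined A u12 \<and>
         Upsilon A u12 *v u12 = mu (a i1) (a i2) (c2 / c1) *\<^sub>R u12 \<and>
         Upsilon_defined A ustar \<and>
         Upsilon A ustar *v ustar = mu (a i1) (a i2) (c2 / c1) *\<^sub>R ustar \<and>
         is_max_value (mu (a i1) (a i2)) (UNIV - {0})
           (((1 - a i1) * (1 - a i2) * (a i1 - a i2) /
             (\<bar>(1 - a i1) * a i1\<bar> + \<bar>(1 - a i2) * a i2\<bar>))\<^sup>2) \<and>
         (a i1 \<noteq> 1 \<and> a i2 \<noteq> 1 \<longrightarrow>
           (\<forall>e \<in> {sqrt \<bar>(1 - a i2) * a i1 / ((1 - a i1) * a i2)\<bar>,
                   - sqrt \<bar>(1 - a i2) * a i1 / ((1 - a i1) * a i2)\<bar>}.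
              is_arg_max (mu (a i1) (a i2)) (\<lambda>x. x \<noteq> 0) e))"
proof -
  let ?a = "a i1" and ?b = "a i2"
  let ?max = "((1 - ?a) * (1 - ?b) * (?a - ?b) / (\<bar>(1 - ?a) * ?a\<bar> + \<bar>(1 - ?b) * ?b\<bar>))\<^sup>2"
  let ?r = "sqrt \<bar>(1 - ?b) * ?a / ((1 - ?a) * ?b)\<bar>"
  define x where "x = (\<Sum>s = 1..N i1. c i1 s *\<^sub>R u i1 s)"
  define y where "y = (\<Sum>r = 1..N i2. c i2 r *\<^sub>R u i2 r)"
  note B1 = assms(5)[OF assms(6)] and B2 = assms(5)[OF assms(7)]
  have x: "A *v x = ?a *\<^sub>R x" "x \<bullet> x = c1\<^sup>2" and y: "A *v y = ?b *\<^sub>R y" "y \<bullet> y = c2\<^sup>2"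
    using orthonormal_basis_of_combination[OF B1, of "c i1"]
      orthonormal_basis_of_combination[OF B2, of "c i2"] assms(13,14)
    by (simp_all add: x_def y_def)
  have u: "A *v u i1 s1 = ?a *\<^sub>R u i1 s1" "u i1 s1 \<bullet> u i1 s1 = 1"
    "A *v u i2 r1 = ?b *\<^sub>R u i2 r1" "u i2 r1 \<bullet> u i2 r1 = 1"
    using B1 B2 assms(11,12) span_base[of "u i1 s1" "u i1 ` {1..N i1}"]
      span_base[of "u i2 r1" "u i2 ` {1..N i2}"]
    by (auto simp: orthonormal_basis_of_def eigenspace_def)
  have "c1\<^sup>2 > 0" "c2\<^sup>2 > 0"
    unfolding assms(13,14) using assms(9,11,12)
    by (auto intro!: sum_pos2[where i = 1])
  then have c: "c1 \<noteq> 0" "c2 \<noteq> 0"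
    by auto
  have nz: "?a \<noteq> 0" "?b \<noteq> 0"
    using invertible_eigenvalue_nonzero[OF assms(1)] u by fastforce+
  have ab: "?a \<noteq> ?b"
    using inj_on_contraD[OF assms(3,8,6,7)] .
  have orth: "v \<bullet> w = 0" if "A *v v = ?a *\<^sub>R v" "A *v w = ?b *\<^sub>R w" for v w
    using symmetric_eigenvectors_orthogonal[OF assms(2) that ab] .
  have "ustar = x + y"
    using assms(10) by (simp only: x_def y_def)
  moreover have "x \<noteq> 0" "y \<noteq> 0" "(c2 / c1)\<^sup>2 = (y \<bullet> y) / (x \<bullet> x)"
    using x(2) y(2) c by (auto simp: power_divide)
  ultimately have ustar: "Upsilon_defined A ustar"
    "Upsilon A ustar *v ustar = mu ?a ?b (c2 / c1) *\<^sub>R ustar"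
    using Upsilon_eigenvector_sum[OF x(1) y(1) orth[OF x(1) y(1)] nz ab] by simp_all
  have u12: "Upsilon_defined A u12" "Upsilon A u12 *v u12 = mu ?a ?b (c2 / c1) *\<^sub>R u12"
  proof -
    have eig: "A *v (c1 *\<^sub>R u i1 s1) = ?a *\<^sub>R (c1 *\<^sub>R u i1 s1)"
      "A *v (c2 *\<^sub>R u i2 r1) = ?b *\<^sub>R (c2 *\<^sub>R u i2 r1)"
      by (simp_all add: matrix_vector_mult_scaleR u mult.commute)
    have "c1 *\<^sub>R u i1 s1 \<noteq> 0" "c2 *\<^sub>R u i2 r1 \<noteq> 0"
      "(c2 / c1)\<^sup>2 = (c2 *\<^sub>R u i2 r1 \<bullet> c2 *\<^sub>R u i2 r1) / (c1 *\<^sub>R u i1 s1 \<bullet> c1 *\<^sub>R u i1 s1)"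
      using c u(2,4) by (auto simp: power_divide power2_eq_square)
    then show "Upsilon_defined A u12" "Upsilon A u12 *v u12 = mu ?a ?b (c2 / c1) *\<^sub>R u12"
      using Upsilon_eigenvector_sum[OF eig orth[OF eig] nz ab]
      unfolding assms(15) by blast+
  qed
  have le: "mu ?a ?b \<epsilon> \<le> ?max" if "\<epsilon> \<noteq> 0" for \<epsilon>
    using mu_le_max[OF that nz] .
  have attained: "e \<noteq> 0 \<and> mu ?a ?b e = ?max" if "?a \<noteq> 1 \<and> ?b \<noteq> 1" "e \<in> {?r, - ?r}" for e
  proof -
    have "e\<^sup>2 = \<bar>(1 - ?b) * ?a / ((1 - ?a) * ?b)\<bar>"
      using that(2) by auto
    then show ?thesis
      using mu_eq_max[OF nz, of e] that(1) nz by auto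
  qed
  have "\<exists>\<epsilon>\<in>UNIV - {0}. mu ?a ?b \<epsilon> = ?max"
  proof (cases "?a \<noteq> 1 \<and> ?b \<noteq> 1")
    case True
    then show ?thesis using attained[of ?r] by blast
  next
    \<comment> \<open>With an eigenvalue \<open>1\<close> the function vanishes identically, so any point will do.\<close>
    case False
    then have "mu ?a ?b 1 = ?max" by (auto simp: mu_def)
    then show ?thesis by (intro bexI[of _ 1]) auto
  qed
  then have max: "is_max_value (mu ?a ?b) (UNIV - {0}) ?max"
    using le by (simp add: is_max_value_def)
  have arg_max: "is_arg_max (mu ?a ?b) (\<lambda>x. x \<noteq> 0) e"
    if "?a \<noteq> 1 \<and> ?b \<noteq> 1" "e \<in> {?r, - ?r}" for e
    using attained[OF that] le unfolding is_arg_max_linorder by metis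
  show ?thesis
    using u12 ustar max arg_max by blast
qed

end
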